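(* If $E=\{n_1<n_2<\cdots\}\subset\mathbb{N}$ satisfies $\lim_{i\to\infty}(n_{i+1}-n_i)=\infty$, then there is a partition $E=E_1\cup E_2$ such that $(E_1-E_1)\cup(E_2-E_2)$ is not syndetic. In particular, there exists a thick set which is not chromatically $E$-intersective.
   Context: $\mathbb{N}=\{1,2,3,\dots\}$, $A-A=\{a-b:a,b\in A\}$. $S\subset\mathbb{N}$ is thick if it contains arbitrarily long intervals of consecutive integers; syndetic if $S-F\supset\mathbb{N}$ for some finite $F$; a set $S\subset\mathbb{Z}$ is syndetic if $S\cap\mathbb{N}$ is. A set $R\subset\mathbb{N}$ is chromatically $E$-intersective if for every finite partition $E=\bigcup_{i=1}^kE_i$ there exists $i$ with $R\cap(E_i-E_i)\neq\varnothing$. *)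

theory Defs
  imports Complex_Main "HOL-Library.Disjoint_Sets"
begin

text \<open>
  The paper's natural numbers start at \<open>1\<close>, while difference sets live in the integers.
  All sets are therefore sets of integers, and \<open>Npos\<close> is the set of positive integers.
\<close>

definition Npos :: "int set" where
  "Npos = {1..}"

definition diff_set :: "int set \<Rightarrow> int set \<Rightarrow> int set" where
  "diff_set A B = {a - b | a b. a \<in> A \<and> b \<in> B}"

definition thick :: "int set \<Rightarrow> bool" where
  "thick S \<longleftrightarrow> S \<subseteq> Npos \<and> (\<forall>L::nat. \<exists>a. {a..<a + int L} \<subseteq> S)"

definition syndetic_pos :: "int set \<Rightarrow> bool" where
  "syndetic_pos S \<longleftrightarrow> S \<subseteq> Npos \<and> (\<exists>F. finite F \<and> Npos \<subseteq> diff_set S F)"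

definition syndetic :: "int set \<Rightarrow> bool" where
  "syndetic S \<longleftrightarrow> syndetic_pos (S \<inter> Npos)"

definition chromatically_intersective :: "int set \<Rightarrow> int set \<Rightarrow> bool" where
  "chromatically_intersective E R \<longleftrightarrow>
     R \<subseteq> Npos \<and>
     (\<forall>P. finite P \<and> partition_on E P \<longrightarrow> (\<exists>C\<in>P. R \<inter> diff_set C C \<noteq> {}))"

end

theory Submission
  imports Defs
begin

text \<open>
  Let \<open>R\<close> be a union of intervals \<open>{M k..M k + k}\<close>, and join \<open>a < b\<close> in \<open>E\<close> by an edge of type \<open>k\<close>
  if \<open>b - a\<close> lies in the \<open>k\<close>-th interval. Given a threshold \<open>f k\<close> beyond which all gaps of \<open>E\<close>
  exceed \<open>k\<close>, choose \<open>M k\<close> such that \<open>{M k..M k + k + f k}\<close> lies in a gap of \<open>E\<close>, which forces the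
  lower end of every edge of type \<open>k\<close> beyond \<open>f k\<close>. As the gaps tend to infinity, there are
  only finitely many edges of type \<open>k\<close>, and \<open>f (Suc k)\<close> is chosen beyond all of them. Edges of
  different types then have disjoint supports, and a vertex has at most one lower neighbour of each
  type. So every vertex has at most one lower neighbour, the graph is a forest, and the two
  classes of a proper 2-colouring have no differences in the thick set \<open>R\<close>.
\<close>

text \<open>Recursion along the well-order: each vertex takes the colour opposite to that of its
  only lower neighbour, if it has one.\<close>

lemma proper_2_colouring_exists:
  fixes edge :: "'a::wellorder \<Rightarrow> 'a \<Rightarrow> bool"
  assumes "\<And>x y z. \<lbrakk>x < z; y < z; edge x z; edge y z\<rbrakk> \<Longrightarrow> x = y"
  shows "\<exists>c :: 'a \<Rightarrow> bool. \<forall>x y. x < y \<longrightarrow> edge x y \<longrightarrow> c x \<noteq> c y"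
proof -
  have "\<exists>c :: 'a \<Rightarrow> bool. \<forall>y. \<forall>x<y. edge x y \<longrightarrow> c x \<noteq> c y"
  proof (rule dependent_wellorder_choice)
    fix y and c :: "'a \<Rightarrow> bool"
    show "\<exists>r. \<forall>x<y. edge x y \<longrightarrow> c x \<noteq> r"
    proof (cases "\<exists>x<y. edge x y")
      case True
      then obtain x where "x < y" "edge x y" by blast
      then have "\<forall>x'<y. edge x' y \<longrightarrow> c x' \<noteq> (\<not> c x)" using assms by blast
      then show ?thesis by blast
    qed blast
  qed auto
  then show ?thesis by blast
qed

text \<open>With \<open>F\<close> inside \<open>{-B..B}\<close>, the centre \<open>x + B\<close> of
  a window of \<open>2 * B + 1\<close> integers in \<open>R\<close> would equal some
  \<open>d - f\<close>, which forces \<open>d\<close> into that window.\<close>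

lemma not_syndetic_if_disjoint_thick:
  assumes "thick R" and disj: "R \<inter> D = {}"
  shows "\<not> syndetic D"
proof
  assume "syndetic D"
  then obtain F where "finite F" and F: "Npos \<subseteq> diff_set (D \<inter> Npos) F"
    by (auto simp: syndetic_def syndetic_pos_def)
  define B where "B = (\<Sum>f\<in>F. \<bar>f\<bar>)"
  have B: "\<bar>f\<bar> \<le> B" if "f \<in> F" for f
    unfolding B_def using \<open>finite F\<close> that by (intro member_le_sum) auto
  have "0 \<le> B" unfolding B_def by (simp add: sum_nonneg)
  obtain x where x: "{x..<x + int (nat (2 * B + 1))} \<subseteq> R"
    using assms(1) unfolding thick_def by blast
  have "x \<in> R" using x \<open>0 \<le> B\<close> by auto
  then have "1 \<le> x" using assms(1) by (auto simp: thick_def Npos_def)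
  then have "x + B \<in> diff_set (D \<inter> Npos) F" using F \<open>0 \<le> B\<close> by (auto simp: Npos_def)
  then obtain d f where "d \<in> D" "f \<in> F" "x + B = d - f" by (auto simp: diff_set_def)
  moreover from this have "d \<in> R" using B[of f] by (intro subsetD[OF x]) auto
  ultimately show False using disj by blast
qed

text \<open>Passes from indices to elements: for \<open>i < j\<close>, the difference
  \<open>n j - n i\<close> is at least the single gap after \<open>n i\<close>.\<close>

lemma gap_beyond_threshold:
  fixes n :: "nat \<Rightarrow> int"
  assumes "strict_mono n" and "filterlim (\<lambda>i. n (Suc i) - n i) at_top sequentially"
  shows "\<exists>T\<ge>0. \<forall>a\<in>range n. \<forall>b\<in>range n. T < a \<longrightarrow> a < b \<longrightarrow> K < b - a"
proof -
  obtain N where N: "\<And>i. N \<le> i \<Longrightarrow> K + 1 \<le> n (Suc i) - n i"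
    using assms(2) by (auto simp: filterlim_at_top eventually_sequentially)
  have "K < n j - n i" if "n N < n i" "n i < n j" for i j
  proof -
    have "N < i" "i < j" using that strict_mono_less[OF assms(1)] by auto
    then have "n (Suc i) \<le> n j" using strict_mono_less_eq[OF assms(1)] by simp
    then show ?thesis using N[of i] \<open>N < i\<close> by simp
  qed
  then show ?thesis by (intro exI[of _ "max 0 (n N)"]) auto
qed

lemma strict_mono_int_unbounded:
  fixes n :: "nat \<Rightarrow> int"
  assumes "strict_mono n"
  shows "\<exists>i. T < n i"
proof -
  have "n 0 + int i \<le> n i" for i
  proof (induction i)
    case (Suc i)
    then show ?case using strict_monoD[OF assms, of i "Suc i"] by simp
  qed simp
  from this[of "nat (T - n 0 + 1)"] show ?thesis by (intro exI[of _ "nat (T - n 0 + 1)"]) linarith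
qed

lemma thick_set_with_unique_lower_neighbours:
  fixes E :: "int set"
  assumes "E \<subseteq> Npos"
    and gap: "\<And>K. \<exists>T\<ge>0. \<forall>a\<in>E. \<forall>b\<in>E. T < a \<longrightarrow> a < b \<longrightarrow> K < b - a"
    and unbounded: "\<And>T. \<exists>a\<in>E. T < a"
  shows "\<exists>R. thick R \<and>
    (\<forall>a\<in>E. \<forall>a'\<in>E. \<forall>b\<in>E. b - a \<in> R \<longrightarrow> b - a' \<in> R \<longrightarrow> a = a')"
proof -
  have pos: "1 \<le> a" if "a \<in> E" for a using that assms(1) by (auto simp: Npos_def)
  \<comment> \<open>\<open>T\<close> is the threshold for gaps of size \<open>k\<close>,
    \<open>M\<close> the start of the \<open>k\<close>-th interval, and \<open>U\<close> the next
    threshold, beyond the upper ends of all edges of type \<open>k\<close>.\<close>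
  let ?P = "\<lambda>k T. 0 \<le> T \<and> (\<forall>a\<in>E. \<forall>b\<in>E. T < a \<longrightarrow> a < b \<longrightarrow> int k < b - a)"
  let ?Q = "\<lambda>k T U. T \<le> U \<and> (\<exists>M\<ge>1. {M..M + int k + T} \<inter> E = {} \<and>
     (\<forall>a\<in>E. \<forall>b\<in>E. a < b \<longrightarrow> b - a \<le> M + int k \<longrightarrow> b \<le> U))"
  have "\<exists>f. \<forall>k. ?P k (f k) \<and> ?Q k (f k) (f (Suc k))"
  proof (rule dependent_nat_choice)
    show "\<exists>T. ?P 0 T" using gap[of 0] by auto
  next
    fix T k
    assume T: "?P k T"
    obtain T1 where T1: "\<And>a b. \<lbrakk>a \<in> E; b \<in> E; T1 < a; a < b\<rbrakk> \<Longrightarrow> T + int k + 1 < b - a"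
      using gap[of "T + int k + 1"] by blast
    obtain e where e: "e \<in> E" "T1 < e" using unbounded by blast
    \<comment> \<open>As \<open>T1 < e\<close>, the next element of \<open>E\<close> after
      \<open>e\<close> exceeds \<open>e + T + int k + 1\<close>, which is the end
      \<open>M + int k + T\<close> of the window to be missed.\<close>
    define M where "M = e + 1"
    have "1 \<le> M" using pos[OF e(1)] by (simp add: M_def)
    have miss: "{M..M + int k + T} \<inter> E = {}" using T1[OF e(1) _ e(2)] by (fastforce simp: M_def)
    obtain T2 where "0 \<le> T2"
      and T2: "\<And>a b. \<lbrakk>a \<in> E; b \<in> E; T2 < a; a < b\<rbrakk> \<Longrightarrow> M + int k < b - a"
      using gap[of "M + int k"] by blast
    \<comment> \<open>If \<open>b - a \<le> M + int k\<close>, then \<open>a \<le> T2\<close>, so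
      \<open>b \<le> T2 + M + int k\<close>. Since \<open>1 \<le> M\<close>, differences beyond
      \<open>U\<close> also exceed \<open>int (Suc k)\<close>.\<close>
    define U where "U = max T (T2 + M + int k)"
    have "b \<le> U" if "a \<in> E" "b \<in> E" "a < b" "b - a \<le> M + int k" for a b
      using T2[OF that(1,2) _ that(3)] that(4) by (force simp: U_def)
    moreover have "int (Suc k) < b - a" if "a \<in> E" "b \<in> E" "U < a" "a < b" for a b
      using T2[OF that(1,2) _ that(4)] that(3) \<open>1 \<le> M\<close> by (simp add: U_def)
    moreover have "T \<le> U" "0 \<le> U" using T by (auto simp: U_def)
    ultimately show "\<exists>U. ?P (Suc k) U \<and> ?Q k T U"
      using \<open>1 \<le> M\<close> miss by (intro exI[of _ U] conjI exI[of _ M]) auto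
  qed
  then obtain f where f: "\<And>k. ?P k (f k)" "\<And>k. ?Q k (f k) (f (Suc k))" by blast
  from f(2) have "\<forall>k. \<exists>M\<ge>1. {M..M + int k + f k} \<inter> E = {} \<and>
     (\<forall>a\<in>E. \<forall>b\<in>E. a < b \<longrightarrow> b - a \<le> M + int k \<longrightarrow> b \<le> f (Suc k))" by blast
  from choice[OF this] obtain M where M: "\<And>k. 1 \<le> M k" "\<And>k. {M k..M k + int k + f k} \<inter> E = {}"
    "\<And>k a b. \<lbrakk>a \<in> E; b \<in> E; a < b; b - a \<le> M k + int k\<rbrakk> \<Longrightarrow> b \<le> f (Suc k)"
    by blast
  have mono: "f j \<le> f k" if "j \<le> k" for j k
    using f(2)[THEN conjunct1] that by (rule lift_Suc_mono_le)
  define R where "R = (\<Union>k. {M k..M k + int k})"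
  have "thick R"
  proof -
    have "{M L..<M L + int L} \<subseteq> R" for L by (force simp: R_def)
    moreover have "R \<subseteq> Npos" using order_trans[OF M(1)] by (auto simp: R_def Npos_def)
    ultimately show ?thesis unfolding thick_def by blast
  qed
  have supp: "f k < a \<and> a < b \<and> b \<le> f (Suc k)"
    if "a \<in> E" "b \<in> E" "b - a \<in> {M k..M k + int k}" for a b k
  proof -
    have "a < b" using that M(1)[of k] by simp
    moreover have "f k < a"
    proof (rule ccontr)
      assume "\<not> f k < a"
      \<comment> \<open>Here \<open>1 \<le> a \<le> f k\<close>, so adding \<open>b - a\<close> to
        \<open>a\<close> lands in the window that misses \<open>E\<close>.\<close>
      then have "b \<in> {M k..M k + int k + f k}" using that pos[OF that(1)] by auto
      then show False using M(2)[of k] that(2) by blast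
    qed
    ultimately show ?thesis using M(3)[of a b k] that by simp
  qed
  have "\<not> a < a'" if E: "a \<in> E" "a' \<in> E" "b \<in> E" and R: "b - a \<in> R" "b - a' \<in> R" for a a' b
  proof
    assume "a < a'"
    obtain j k where j: "b - a \<in> {M j..M j + int j}" and k: "b - a' \<in> {M k..M k + int k}"
      using R by (auto simp: R_def)
    note sj = supp[OF E(1,3) j] and sk = supp[OF E(2,3) k]
    \<comment> \<open>The intervals \<open>{f i<..f (Suc i)}\<close> are pairwise disjoint, and
      \<open>b\<close> lies in those for \<open>j\<close> and \<open>k\<close>. Once
      \<open>j = k\<close>, both differences share an interval of length \<open>k\<close>, too short
      for a gap beyond \<open>f k\<close>.\<close>
    have "j = k" using mono[of "Suc j" k] mono[of "Suc k" j] sj sk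
      by (cases j k rule: linorder_cases) auto
    then have "a' - a \<le> int k" using j k by auto
    moreover have "int k < a' - a" using f(1)[of k] E sj \<open>j = k\<close> \<open>a < a'\<close> by blast
    ultimately show False by simp
  qed
  then have "\<forall>a\<in>E. \<forall>a'\<in>E. \<forall>b\<in>E. b - a \<in> R \<longrightarrow> b - a' \<in> R \<longrightarrow> a = a'"
    by (metis linorder_less_linear)
  with \<open>thick R\<close> show ?thesis by blast
qed

lemma partition_avoiding_differences:
  fixes E R :: "int set"
  assumes "E \<subseteq> Npos" "R \<subseteq> Npos"
    and uniq: "\<And>a a' b. \<lbrakk>a \<in> E; a' \<in> E; b \<in> E; b - a \<in> R; b - a' \<in> R\<rbrakk> \<Longrightarrow> a = a'"
    and two: "x \<in> E" "y \<in> E" "x \<noteq> y"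
  shows "\<exists>E1 E2. E1 \<noteq> E2 \<and> partition_on E {E1, E2} \<and> R \<inter> (diff_set E1 E1 \<union> diff_set E2 E2) = {}"
proof -
  \<comment> \<open>The colouring needs a well-order, so the graph is moved from \<open>int\<close>
    to \<open>nat\<close>; nothing is lost, as \<open>E\<close> is positive.\<close>
  let ?edge = "\<lambda>i j. int i \<in> E \<and> int j \<in> E \<and> int j - int i \<in> R"
  have "\<exists>c :: nat \<Rightarrow> bool. \<forall>i j. i < j \<longrightarrow> ?edge i j \<longrightarrow> c i \<noteq> c j"
    using uniq by (intro proper_2_colouring_exists) (metis of_nat_eq_iff)
  then obtain c :: "nat \<Rightarrow> bool" where c: "\<And>i j. \<lbrakk>i < j; ?edge i j\<rbrakk> \<Longrightarrow> c i \<noteq> c j" by blast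
  have colour: "c (nat a) \<noteq> c (nat b)" if "a \<in> E" "b \<in> E" "b - a \<in> R" for a b
  proof -
    have "0 < a" "0 < b" "0 < b - a" using that assms(1,2) by (auto simp: Npos_def)
    then show ?thesis using c[of "nat a" "nat b"] that by simp
  qed
  define E0 where "E0 = {a \<in> E. c (nat a)}"
  \<comment> \<open>A constant colouring yields an empty class, but then \<open>E\<close> has no differences in \<open>R\<close> at all.\<close>
  define E1 where "E1 = (if E0 = {} \<or> E0 = E then {x} else E0)"
  have "E1 \<noteq> {}" "E1 \<subseteq> E" "E - E1 \<noteq> {}" using two by (auto simp: E1_def E0_def)
  then have "partition_on E {E1, E - E1}" "E1 \<noteq> E - E1"
    by (auto simp: partition_on_def disjoint_def)
  moreover have "(a \<in> E1) \<noteq> (b \<in> E1)" if "a \<in> E" "b \<in> E" "b - a \<in> R" for a b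
    using colour[OF that] that by (auto simp: E1_def E0_def)
  then have "R \<inter> (diff_set E1 E1 \<union> diff_set (E - E1) (E - E1)) = {}"
    using \<open>E1 \<subseteq> E\<close> by (fastforce simp: diff_set_def)
  ultimately show ?thesis by (intro exI[of _ E1] exI[of _ "E - E1"] conjI)
qed

theorem theoremG:
  fixes E :: "int set" and n :: "nat \<Rightarrow> int"
  assumes "E \<subseteq> Npos"
    and "strict_mono n"
    and "E = range n"
    and "filterlim (\<lambda>i. n (Suc i) - n i) at_top sequentially"
  shows "(\<exists>E1 E2. E1 \<noteq> E2 \<and> partition_on E {E1, E2} \<and>
            \<not> syndetic (diff_set E1 E1 \<union> diff_set E2 E2)) \<and>
         (\<exists>R. thick R \<and> \<not> chromatically_intersective E R)"
proof -
  have "\<exists>T\<ge>0. \<forall>a\<in>E. \<forall>b\<in>E. T < a \<longrightarrow> a < b \<longrightarrow> K < b - a" for K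
    using gap_beyond_threshold[OF assms(2,4)] assms(3) by simp
  moreover have "\<exists>a\<in>E. T < a" for T
    using strict_mono_int_unbounded[OF assms(2), of T] assms(3) by blast
  ultimately obtain R where "thick R"
    and R: "\<And>a a' b. \<lbrakk>a \<in> E; a' \<in> E; b \<in> E; b - a \<in> R; b - a' \<in> R\<rbrakk> \<Longrightarrow> a = a'"
    using thick_set_with_unique_lower_neighbours[OF assms(1)] by blast
  have "R \<subseteq> Npos" using \<open>thick R\<close> by (simp add: thick_def)
  moreover have "n 0 \<in> E" "n 1 \<in> E" "n 0 \<noteq> n 1"
    using assms(2,3) by (auto simp: strict_mono_eq)
  ultimately obtain E1 E2 where E12: "E1 \<noteq> E2" "partition_on E {E1, E2}"
      "R \<inter> (diff_set E1 E1 \<union> diff_set E2 E2) = {}"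
    using partition_avoiding_differences[OF assms(1), of R "n 0" "n 1"] R by blast
  have "\<not> syndetic (diff_set E1 E1 \<union> diff_set E2 E2)"
    by (rule not_syndetic_if_disjoint_thick[OF \<open>thick R\<close> E12(3)])
  \<comment> \<open>The same two classes are a finite partition in which no class has a difference
    in \<open>R\<close>.\<close>
  moreover have "\<not> chromatically_intersective E R"
  proof
    assume "chromatically_intersective E R"
    then have "\<forall>P. finite P \<and> partition_on E P \<longrightarrow> (\<exists>C\<in>P. R \<inter> diff_set C C \<noteq> {})"
      unfolding chromatically_intersective_def by (rule conjunct2)
    from this[rule_format, of "{E1, E2}"] have "\<exists>C\<in>{E1, E2}. R \<inter> diff_set C C \<noteq> {}"
      using E12(2) by simp
    then show False using E12(3) by auto
  qed
  ultimately show ?thesis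
    using E12(1,2) \<open>thick R\<close> by (intro conjI exI[of _ E1] exI[of _ E2] exI[of _ R])
qed

end
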